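(* Let $E_u$ be a Dedekind complete Riesz space with strong order unit $u$, and let $T$ be a strictly positive conditional expectation on $E_u$. Let $f_1,\dots,f_n$ be $T$-conditionally independent elements of $E_u$. Let $$S=\sum_{i=1}^n\bigl(f_i-T(f_i)\bigr),\qquad v=\sum_{i=1}^nT(f_i^2).$$ Then for every real $t>0$, $$\Psi_S(t):=\log\bigl(T(\exp(tS))\bigr)\leq (e^t-t-1)\,v,$$ and, if $v$ is invertible in $E_u$, then for every positive real number $x$, $$TP_{(S-xu)^+}u\;\leq\;\exp\left[-\|v\|_u\left(\Bigl(1+\frac{x}{\|v\|_u}\Bigr)\log\Bigl(1+\frac{x}{\|v\|_u}\Bigr)-\frac{x}{\|v\|_u}\right)\right]u.$$
   Context: $E_u$ is a Dedekind complete Riesz space with strong order unit $u$. By the Yosida representation theorem there are a compact Hausdorff space $K$ and a Riesz isomorphism $\varphi:E_u\to C(K)$ with $\varphi(u)=1$; $E_u$ carries the $f$-algebra multiplication transported by $\varphi$, for which $u$ is the unit. The gauge norm is $\|x\|_u=\inf\{\beta\in\mathbb{R}: |x|\le\beta u\}$. Set $\exp(x)=\varphi^{-1}(\exp\circ\varphi(x))$ for $x\in E_u$ and $\log(x)=\varphi^{-1}(\log\circ\varphi(x))$ for positive invertible $x\in E_u$. A conditional expectation $T$ is a positive order continuous linear projection mapping weak order units to weak order units whose range $R(T)$ is a Dedekind complete Riesz subspace. It is strictly positive if $T|x|=0$ implies $x=0$. For $x\in E_u$, $P_{x^+}$ is the band projection onto the band generated by $x^+$. Independence: band projections $P,Q$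 are $T$-conditionally independent if $TPQu=TPu\cdot TQu$. Two Riesz subspaces $E_1,E_2$ are $T$-conditionally independent if all band projections $P_1,P_2$ with $P_iu\in E_i$ are $T$-conditionally independent. A family $(E_\lambda)_{\lambda\in\Lambda}$ of closed Dedekind complete Riesz subspaces containing $R(T)$ is $T$-conditionally independent if for every pair of disjoint subsets $\Lambda_1,\Lambda_2\subset\Lambda$ the closed Riesz subspaces generated by $\bigcup_{\lambda\in\Lambda_1}E_\lambda$ and by $\bigcup_{\lambda\in\Lambda_2}E_\lambda$ are $T$-conditionally independent. Elements $(f_i)$ are $T$-conditionally independent if the family of closed Riesz subspaces $\langle\{f_i\}\cup R(T)\rangle$ generated by $f_i$ and $R(T)$ is.
   Formalization: The formal theorem additionally assumes f_i ≤ u for every i (the classical one-sided Bennett bound) and T(u) = u; without either of these the stated inequalities fail, as two-dimensional examples show. *)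

theory Defs
  imports "HOL-Analysis.Analysis" "HOL-Library.Lattice_Algebras"
begin

text \<open>
  The axioms of \<open>conditionally_complete_lattice\<close> (every nonempty set that is bounded above has a
  supremum, and dually) are exactly Dedekind completeness.
\<close>

class dedekind_complete_riesz_space =
  ordered_real_vector + conditionally_complete_lattice + lattice_ab_group_add_abs

definition strong_order_unit :: "'a::dedekind_complete_riesz_space \<Rightarrow> bool" where
  "strong_order_unit u \<longleftrightarrow> 0 \<le> u \<and> (\<forall>x. \<exists>\<beta>::real. \<bar>x\<bar> \<le> \<beta> *\<^sub>R u)"

definition gauge_norm :: "'a::dedekind_complete_riesz_space \<Rightarrow> 'a \<Rightarrow> real" where
  "gauge_norm u x = Inf {\<beta>::real. \<bar>x\<bar> \<le> \<beta> *\<^sub>R u}"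


subsection \<open>Order convergence, Riesz subspaces, bands\<close>

text \<open>
  Order convergence, phrased for filters: a net converges in order to \<open>x\<close> iff its filter of tails
  does. The set \<open>D\<close> is the range of a net decreasing to \<open>0\<close>.
\<close>

definition order_convergent_to :: "'a::dedekind_complete_riesz_space filter \<Rightarrow> 'a \<Rightarrow> bool" where
  "order_convergent_to F x \<longleftrightarrow>
     (\<exists>D. D \<noteq> {} \<and> bdd_below D \<and> (\<forall>a\<in>D. \<forall>b\<in>D. \<exists>c\<in>D. c \<le> a \<and> c \<le> b) \<and> Inf D = 0 \<and>
          (\<forall>d\<in>D. eventually (\<lambda>y. \<bar>y - x\<bar> \<le> d) F))"

definition order_closed :: "'a::dedekind_complete_riesz_space set \<Rightarrow> bool" where
  "order_closed A \<longleftrightarrow>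
     (\<forall>F x. F \<noteq> bot \<and> eventually (\<lambda>y. y \<in> A) F \<and> order_convergent_to F x \<longrightarrow> x \<in> A)"

definition order_continuous ::
    "('a::dedekind_complete_riesz_space \<Rightarrow> 'a) \<Rightarrow> bool" where
  "order_continuous T \<longleftrightarrow>
     (\<forall>F x. order_convergent_to F x \<longrightarrow> order_convergent_to (filtermap T F) (T x))"

definition riesz_subspace :: "'a::dedekind_complete_riesz_space set \<Rightarrow> bool" where
  "riesz_subspace A \<longleftrightarrow> subspace A \<and> (\<forall>x\<in>A. \<forall>y\<in>A. sup x y \<in> A \<and> inf x y \<in> A)"

text \<open>
  Dedekind completeness of the subspace as a Riesz space in its own right: bounds and suprema are
  taken inside \<open>A\<close>.
\<close>

definition dedekind_complete_subspace :: "'a::dedekind_complete_riesz_space set \<Rightarrow> bool" where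
  "dedekind_complete_subspace A \<longleftrightarrow> riesz_subspace A \<and>
     (\<forall>B\<subseteq>A. B \<noteq> {} \<and> (\<exists>c\<in>A. \<forall>b\<in>B. b \<le> c) \<longrightarrow>
        (\<exists>s\<in>A. (\<forall>b\<in>B. b \<le> s) \<and> (\<forall>c\<in>A. (\<forall>b\<in>B. b \<le> c) \<longrightarrow> s \<le> c)))"

definition closed_riesz_subspace :: "'a::dedekind_complete_riesz_space set \<Rightarrow> bool" where
  "closed_riesz_subspace A \<longleftrightarrow> riesz_subspace A \<and> order_closed A"

definition band :: "'a::dedekind_complete_riesz_space set \<Rightarrow> bool" where
  "band B \<longleftrightarrow> subspace B \<and> (\<forall>x\<in>B. \<forall>y. \<bar>y\<bar> \<le> \<bar>x\<bar> \<longrightarrow> y \<in> B) \<and> order_closed B"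

definition disjoint_complement :: "'a::dedekind_complete_riesz_space set \<Rightarrow> 'a set" where
  "disjoint_complement B = {x. \<forall>b\<in>B. inf \<bar>x\<bar> \<bar>b\<bar> = 0}"

definition band_proj :: "'a::dedekind_complete_riesz_space set \<Rightarrow> 'a \<Rightarrow> 'a" where
  "band_proj B x = (THE y. y \<in> B \<and> x - y \<in> disjoint_complement B)"

definition is_band_projection :: "('a::dedekind_complete_riesz_space \<Rightarrow> 'a) \<Rightarrow> bool" where
  "is_band_projection P \<longleftrightarrow> (\<exists>B. band B \<and> P = band_proj B)"

definition weak_order_unit :: "'a::dedekind_complete_riesz_space \<Rightarrow> bool" where
  "weak_order_unit e \<longleftrightarrow> 0 \<le> e \<and> band hull {e} = UNIV"


subsection \<open>Functional calculus from a Yosida representation\<close>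

text \<open>
  Elements of \<open>C(K)\<close> are represented by their extensional versions, so that a function on
  \<open>topspace K\<close> has exactly one representative and \<open>\<phi>\<close> can be a bijection. Taking \<open>K\<close> to be a topology
  rather than a type also admits \<open>K = {}\<close>, which is what the zero space requires.
\<close>

definition continuous_functions :: "'k topology \<Rightarrow> ('k \<Rightarrow> real) set" where
  "continuous_functions K = {g \<in> extensional (topspace K). continuous_map K euclideanreal g}"

definition yosida_representation ::
    "'k topology \<Rightarrow> ('a::dedekind_complete_riesz_space \<Rightarrow> 'k \<Rightarrow> real) \<Rightarrow> 'a \<Rightarrow> bool" where
  "yosida_representation K \<phi> u \<longleftrightarrow>
     compact_space K \<and> Hausdorff_space K \<and>
     bij_betw \<phi> UNIV (continuous_functions K) \<and>
     (\<forall>x y. \<forall>p\<in>topspace K. \<phi> (x + y) p = \<phi> x p + \<phi> y p) \<and>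
     (\<forall>c x. \<forall>p\<in>topspace K. \<phi> (c *\<^sub>R x) p = c * \<phi> x p) \<and>
     (\<forall>x y. \<forall>p\<in>topspace K. \<phi> (sup x y) p = max (\<phi> x p) (\<phi> y p)) \<and>
     (\<forall>x y. \<forall>p\<in>topspace K. \<phi> (inf x y) p = min (\<phi> x p) (\<phi> y p)) \<and>
     (\<forall>p\<in>topspace K. \<phi> u p = 1)"

definition yosida_mult ::
    "'k topology \<Rightarrow> ('a::dedekind_complete_riesz_space \<Rightarrow> 'k \<Rightarrow> real) \<Rightarrow> 'a \<Rightarrow> 'a \<Rightarrow> 'a" where
  "yosida_mult K \<phi> x y = inv \<phi> (\<lambda>p\<in>topspace K. \<phi> x p * \<phi> y p)"

definition yosida_exp ::
    "'k topology \<Rightarrow> ('a::dedekind_complete_riesz_space \<Rightarrow> 'k \<Rightarrow> real) \<Rightarrow> 'a \<Rightarrow> 'a" where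
  "yosida_exp K \<phi> x = inv \<phi> (\<lambda>p\<in>topspace K. exp (\<phi> x p))"

text \<open>Only meaningful for positive invertible \<open>x\<close>, i.e. when \<open>\<phi> x > 0\<close> on \<open>K\<close>.\<close>

definition yosida_log ::
    "'k topology \<Rightarrow> ('a::dedekind_complete_riesz_space \<Rightarrow> 'k \<Rightarrow> real) \<Rightarrow> 'a \<Rightarrow> 'a" where
  "yosida_log K \<phi> x = inv \<phi> (\<lambda>p\<in>topspace K. ln (\<phi> x p))"

definition yosida_invertible ::
    "'k topology \<Rightarrow> ('a::dedekind_complete_riesz_space \<Rightarrow> 'k \<Rightarrow> real) \<Rightarrow> 'a \<Rightarrow> 'a \<Rightarrow> bool" where
  "yosida_invertible K \<phi> u x \<longleftrightarrow> (\<exists>y. yosida_mult K \<phi> x y = u)"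


subsection \<open>Conditional expectations and independence\<close>

definition conditional_expectation ::
    "('a::dedekind_complete_riesz_space \<Rightarrow> 'a) \<Rightarrow> bool" where
  "conditional_expectation T \<longleftrightarrow>
     linear T \<and> (\<forall>x. 0 \<le> x \<longrightarrow> 0 \<le> T x) \<and> order_continuous T \<and> (\<forall>x. T (T x) = T x) \<and>
     (\<forall>e. weak_order_unit e \<longrightarrow> weak_order_unit (T e)) \<and> dedekind_complete_subspace (range T)"

definition strictly_positive ::
    "('a::dedekind_complete_riesz_space \<Rightarrow> 'a) \<Rightarrow> bool" where
  "strictly_positive T \<longleftrightarrow> (\<forall>x. T \<bar>x\<bar> = 0 \<longrightarrow> x = 0)"

definition indep_projections ::
    "'k topology \<Rightarrow> ('a::dedekind_complete_riesz_space \<Rightarrow> 'k \<Rightarrow> real) \<Rightarrow> 'a \<Rightarrow> ('a \<Rightarrow> 'a) \<Rightarrow>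
     ('a \<Rightarrow> 'a) \<Rightarrow> ('a \<Rightarrow> 'a) \<Rightarrow> bool" where
  "indep_projections K \<phi> u T P Q \<longleftrightarrow> T (P (Q u)) = yosida_mult K \<phi> (T (P u)) (T (Q u))"

definition indep_subspaces ::
    "'k topology \<Rightarrow> ('a::dedekind_complete_riesz_space \<Rightarrow> 'k \<Rightarrow> real) \<Rightarrow> 'a \<Rightarrow> ('a \<Rightarrow> 'a) \<Rightarrow>
     'a set \<Rightarrow> 'a set \<Rightarrow> bool" where
  "indep_subspaces K \<phi> u T E1 E2 \<longleftrightarrow>
     (\<forall>P1 P2. is_band_projection P1 \<and> is_band_projection P2 \<and> P1 u \<in> E1 \<and> P2 u \<in> E2 \<longrightarrow>
        indep_projections K \<phi> u T P1 P2)"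

definition indep_family ::
    "'k topology \<Rightarrow> ('a::dedekind_complete_riesz_space \<Rightarrow> 'k \<Rightarrow> real) \<Rightarrow> 'a \<Rightarrow> ('a \<Rightarrow> 'a) \<Rightarrow>
     'i set \<Rightarrow> ('i \<Rightarrow> 'a set) \<Rightarrow> bool" where
  "indep_family K \<phi> u T \<Lambda> E \<longleftrightarrow>
     (\<forall>i\<in>\<Lambda>. closed_riesz_subspace (E i) \<and> dedekind_complete_subspace (E i) \<and> range T \<subseteq> E i) \<and>
     (\<forall>\<Lambda>1 \<Lambda>2. \<Lambda>1 \<subseteq> \<Lambda> \<and> \<Lambda>2 \<subseteq> \<Lambda> \<and> \<Lambda>1 \<inter> \<Lambda>2 = {} \<longrightarrow>
        indep_subspaces K \<phi> u T
          (closed_riesz_subspace hull (\<Union>i\<in>\<Lambda>1. E i))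
          (closed_riesz_subspace hull (\<Union>i\<in>\<Lambda>2. E i)))"

definition indep_elements ::
    "'k topology \<Rightarrow> ('a::dedekind_complete_riesz_space \<Rightarrow> 'k \<Rightarrow> real) \<Rightarrow> 'a \<Rightarrow> ('a \<Rightarrow> 'a) \<Rightarrow>
     'i set \<Rightarrow> ('i \<Rightarrow> 'a) \<Rightarrow> bool" where
  "indep_elements K \<phi> u T \<Lambda> f \<longleftrightarrow>
     indep_family K \<phi> u T \<Lambda> (\<lambda>i. closed_riesz_subspace hull ({f i} \<union> range T))"

end

theory Submission
  imports Defs
begin

text \<open>
  Through the Yosida representation every identity and inequality can be checked pointwise on \<open>K\<close>.
  A closed Riesz subspace containing \<open>u\<close> is the uniform closure of the span of its components of
  \<open>u\<close> (Freudenthal), so linear, uniformly continuous identities need only be verified on components.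
  This yields the averaging property \<open>T (x y) = x T y\<close> for \<open>x\<close> in the range of \<open>T\<close>, and upgrades
  independence from band projections to \<open>T (x y) = T x T y\<close> on independent closed subspaces, hence
  the factorisation of \<open>T (exp (t S))\<close>. Each factor is estimated by \<open>ln z \<le> z - 1\<close> and
  \<open>exp (t y) - t y - 1 \<le> (exp t - t - 1) y\<^sup>2\<close> for \<open>y \<le> 1\<close>. The tail bound is Chernoff's argument
  with \<open>t = ln (1 + x / \<parallel>v\<parallel>)\<close>.
\<close>

subsection \<open>Order convergence and hulls\<close>

lemma closed_riesz_subspace_hull: "closed_riesz_subspace (closed_riesz_subspace hull A)"
proof (rule hull_in)
  fix \<A> :: "'a set set"
  assume *: "Ball \<A> closed_riesz_subspace"
  have "order_closed (\<Inter>\<A>)"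
    unfolding order_closed_def
  proof (intro allI impI InterI)
    fix F x B
    assume F: "F \<noteq> bot \<and> eventually (\<lambda>y. y \<in> \<Inter>\<A>) F \<and> order_convergent_to F x" and B: "B \<in> \<A>"
    have "eventually (\<lambda>y. y \<in> B) F"
      using F B by (auto elim: eventually_mono)
    then show "x \<in> B"
      using F B * unfolding closed_riesz_subspace_def order_closed_def by blast
  qed
  moreover have "subspace (\<Inter>\<A>)"
    using * by (intro subspace_Inter) (auto simp: closed_riesz_subspace_def riesz_subspace_def)
  ultimately show "closed_riesz_subspace (\<Inter>\<A>)"
    using * unfolding closed_riesz_subspace_def riesz_subspace_def by blast
qed

lemma band_hull: "band (band hull A)"
proof (rule hull_in)
  fix \<A> :: "'a set set"
  assume *: "Ball \<A> band"
  have "order_closed (\<Inter>\<A>)"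
    unfolding order_closed_def
  proof (intro allI impI InterI)
    fix F x B
    assume F: "F \<noteq> bot \<and> eventually (\<lambda>y. y \<in> \<Inter>\<A>) F \<and> order_convergent_to F x" and B: "B \<in> \<A>"
    have "eventually (\<lambda>y. y \<in> B) F"
      using F B by (auto elim: eventually_mono)
    then show "x \<in> B"
      using F B * unfolding band_def order_closed_def by blast
  qed
  moreover have "subspace (\<Inter>\<A>)"
    using * by (intro subspace_Inter) (auto simp: band_def)
  ultimately show "band (\<Inter>\<A>)"
    using * unfolding band_def by blast
qed

lemma order_convergent_to_incseq:
  fixes e :: "nat \<Rightarrow> 'a::dedekind_complete_riesz_space"
  assumes "incseq e" "bdd_above (range e)"
  shows "order_convergent_to (filtermap e sequentially) (Sup (range e))"
  unfolding order_convergent_to_def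
proof (intro exI[of _ "range (\<lambda>n. Sup (range e) - e n)"] conjI ballI)
  let ?s = "Sup (range e)"
  have up: "e n \<le> ?s" for n
    using assms(2) by (simp add: cSup_upper)
  show "range (\<lambda>n. ?s - e n) \<noteq> {}" by simp
  show bdd: "bdd_below (range (\<lambda>n. ?s - e n))"
    using up by (intro bdd_belowI[of _ 0]) auto
  show "\<exists>c\<in>range (\<lambda>n. ?s - e n). c \<le> a \<and> c \<le> b"
    if ab: "a \<in> range (\<lambda>n. ?s - e n)" "b \<in> range (\<lambda>n. ?s - e n)" for a b
  proof -
    obtain m n where "a = ?s - e m" "b = ?s - e n" using ab by blast
    moreover have "e m \<le> e (max m n)" "e n \<le> e (max m n)"
      using assms(1) by (auto simp: incseq_def)
    ultimately show ?thesis by (auto intro!: bexI[of _ "?s - e (max m n)"] diff_left_mono)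
  qed
  show "Inf (range (\<lambda>n. ?s - e n)) = 0"
  proof (rule antisym)
    let ?i = "Inf (range (\<lambda>n. ?s - e n))"
    have "?i \<le> ?s - e n" for n
      using bdd by (simp add: cInf_lower)
    then have "e n \<le> ?s - ?i" for n
      by (metis add.commute le_diff_eq)
    then have "?s \<le> ?s - ?i"
      by (intro cSup_least) auto
    then show "?i \<le> 0" by simp
    show "0 \<le> ?i" using up by (intro cInf_greatest) auto
  qed
  show "eventually (\<lambda>y. \<bar>y - ?s\<bar> \<le> d) (filtermap e sequentially)"
    if d: "d \<in> range (\<lambda>n. ?s - e n)" for d
  proof -
    obtain n where n: "d = ?s - e n" using d by blast
    have "\<bar>e m - ?s\<bar> \<le> d" if "m \<ge> n" for m
    proof -
      have "\<bar>e m - ?s\<bar> = ?s - e m" using up[of m] by (subst abs_minus_commute) simp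
      then show ?thesis
        using assms(1) that by (simp add: n incseq_def diff_left_mono)
    qed
    then show ?thesis unfolding eventually_filtermap eventually_sequentially by blast
  qed
qed

lemma order_closed_Sup_incseq:
  fixes e :: "nat \<Rightarrow> 'a::dedekind_complete_riesz_space"
  assumes "order_closed A" "incseq e" "bdd_above (range e)" "range e \<subseteq> A"
  shows "Sup (range e) \<in> A"
proof -
  have "eventually (\<lambda>y. y \<in> A) (filtermap e sequentially)"
    unfolding eventually_filtermap using assms(4) by (intro always_eventually) blast
  then show ?thesis
    using assms(1) order_convergent_to_incseq[OF assms(2,3)]
    unfolding order_closed_def by (metis filtermap_bot_iff trivial_limit_sequentially)
qed

lemma order_convergent_to_unique:
  assumes F: "F \<noteq> bot" and x: "order_convergent_to F x" and y: "order_convergent_to F y"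
  shows "x = y"
proof -
  obtain D where D: "D \<noteq> {}" "Inf D = 0" "\<And>d. d \<in> D \<Longrightarrow> eventually (\<lambda>z. \<bar>z - x\<bar> \<le> d) F"
    using x unfolding order_convergent_to_def by blast
  obtain D' where D': "D' \<noteq> {}" "Inf D' = 0" "\<And>d. d \<in> D' \<Longrightarrow> eventually (\<lambda>z. \<bar>z - y\<bar> \<le> d) F"
    using y unfolding order_convergent_to_def by blast
  have "\<bar>x - y\<bar> \<le> d + d'" if "d \<in> D" "d' \<in> D'" for d d'
  proof -
    have "eventually (\<lambda>z. \<bar>z - x\<bar> \<le> d \<and> \<bar>z - y\<bar> \<le> d') F"
      using D(3)[OF that(1)] D'(3)[OF that(2)] by (rule eventually_conj)
    then obtain z where z: "\<bar>z - x\<bar> \<le> d" "\<bar>z - y\<bar> \<le> d'"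
      using eventually_happens'[OF F] by blast
    have "\<bar>x - y\<bar> \<le> \<bar>x - z\<bar> + \<bar>z - y\<bar>"
      using abs_triangle_ineq[of "x - z" "z - y"] by simp
    also have "\<dots> \<le> d + d'"
      using z by (intro add_mono) (simp_all add: abs_minus_commute)
    finally show ?thesis .
  qed
  then have "\<bar>x - y\<bar> - d' \<le> Inf D" if "d' \<in> D'" for d'
    using that D(1) by (intro cInf_greatest) (auto simp: diff_le_eq)
  then have "\<bar>x - y\<bar> \<le> Inf D'"
    using D'(1) by (intro cInf_greatest) (auto simp: D(2))
  then have "\<bar>x - y\<bar> = 0"
    unfolding D'(2) using abs_ge_zero antisym by blast
  then show ?thesis by simp
qed

lemma order_closed_range_projection:
  assumes "order_continuous T" "\<And>x. T (T x) = T x"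
  shows "order_closed (range T)"
  unfolding order_closed_def
proof (intro allI impI)
  fix F x
  assume *: "F \<noteq> bot \<and> eventually (\<lambda>y. y \<in> range T) F \<and> order_convergent_to F x"
  then have ev: "eventually (\<lambda>y. T y = y) F"
    using assms(2) by (auto elim!: eventually_mono)
  have "filtermap T F = F"
    by (rule filter_eqI, unfold eventually_filtermap, rule eventually_cong[OF ev]) simp
  then have "order_convergent_to F (T x)"
    using * assms(1) unfolding order_continuous_def by metis
  then have "x = T x"
    using * order_convergent_to_unique by blast
  then show "x \<in> range T" by blast
qed

subsection \<open>Pointwise calculus in a Yosida representation\<close>

locale yosida_space =
  fixes u :: "'a::dedekind_complete_riesz_space"
    and K :: "'k topology" and \<phi> :: "'a \<Rightarrow> 'k \<Rightarrow> real"
  assumes unit: "strong_order_unit u" and rep: "yosida_representation K \<phi> u"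
begin

abbreviation X :: "'k set" where "X \<equiv> topspace K"

abbreviation mult :: "'a \<Rightarrow> 'a \<Rightarrow> 'a"  (infixl "\<star>" 70) where "x \<star> y \<equiv> yosida_mult K \<phi> x y"

abbreviation Exp :: "'a \<Rightarrow> 'a" where "Exp \<equiv> yosida_exp K \<phi>"

lemma phi_simps [simp]:
  assumes "p \<in> X"
  shows "\<phi> (x + y) p = \<phi> x p + \<phi> y p" "\<phi> (c *\<^sub>R x) p = c * \<phi> x p"
    "\<phi> (sup x y) p = max (\<phi> x p) (\<phi> y p)" "\<phi> (inf x y) p = min (\<phi> x p) (\<phi> y p)" "\<phi> u p = 1"
  using rep assms unfolding yosida_representation_def by auto

lemma phi_bij: "bij_betw \<phi> UNIV (continuous_functions K)"
  using rep unfolding yosida_representation_def by blast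

lemma phi_mem: "\<phi> x \<in> continuous_functions K"
  using phi_bij by (auto simp: bij_betw_def)

lemma continuous_phi: "continuous_map K euclideanreal (\<phi> x)"
  using phi_mem by (auto simp: continuous_functions_def)

lemma phi_eqI:
  assumes "\<And>p. p \<in> X \<Longrightarrow> \<phi> x p = \<phi> y p"
  shows "x = y"
proof -
  have "\<phi> x = \<phi> y"
    using assms phi_mem[of x] phi_mem[of y] unfolding continuous_functions_def
    by (auto intro: extensionalityI)
  then show ?thesis using phi_bij by (simp add: bij_betw_def inj_eq)
qed

lemma phi_le_iff: "x \<le> y \<longleftrightarrow> (\<forall>p\<in>X. \<phi> x p \<le> \<phi> y p)"
proof -
  have "x \<le> y \<longleftrightarrow> sup x y = y" by (simp add: le_iff_sup)
  also have "\<dots> \<longleftrightarrow> (\<forall>p\<in>X. \<phi> (sup x y) p = \<phi> y p)" using phi_eqI by metis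
  also have "\<dots> \<longleftrightarrow> (\<forall>p\<in>X. \<phi> x p \<le> \<phi> y p)" by (auto simp: max_def)
  finally show ?thesis .
qed

lemma phi_derived [simp]:
  assumes "p \<in> X"
  shows "\<phi> 0 p = 0" "\<phi> (- x) p = - \<phi> x p" "\<phi> (x - y) p = \<phi> x p - \<phi> y p"
    "\<phi> \<bar>x\<bar> p = \<bar>\<phi> x p\<bar>" "\<phi> (pprt x) p = max (\<phi> x p) 0"
proof -
  show zero: "\<phi> 0 p = 0" using phi_simps(2)[OF assms, of 0 0] by simp
  show uminus: "\<phi> (- x) p = - \<phi> x p" for x using phi_simps(2)[OF assms, of "-1" x] by simp
  show "\<phi> (x - y) p = \<phi> x p - \<phi> y p" using assms uminus by (metis phi_simps(1) diff_conv_add_uminus)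
  have "\<bar>x\<bar> = sup x (- x)" by (rule abs_lattice)
  then show "\<phi> \<bar>x\<bar> p = \<bar>\<phi> x p\<bar>" using assms uminus[of x] by (simp add: abs_real_def max_def)
  show "\<phi> (pprt x) p = max (\<phi> x p) 0" using assms zero by (simp add: pprt_def)
qed

lemma phi_sum [simp]: "p \<in> X \<Longrightarrow> \<phi> (sum g I) p = (\<Sum>i\<in>I. \<phi> (g i) p)"
  by (induction I rule: infinite_finite_induct) auto

lemma phi_inv:
  assumes "continuous_map K euclideanreal g" "p \<in> X"
  shows "\<phi> (inv \<phi> (restrict g X)) p = g p"
proof -
  have "continuous_map K euclideanreal (restrict g X)"
    using assms(1) by (rule continuous_map_eq) simp
  then have "restrict g X \<in> range \<phi>"
    using phi_bij by (auto simp: bij_betw_def continuous_functions_def)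
  then show ?thesis using assms(2) by (simp add: f_inv_into_f)
qed

lemma phi_mult [simp]: "p \<in> X \<Longrightarrow> \<phi> (x \<star> y) p = \<phi> x p * \<phi> y p"
  unfolding yosida_mult_def
  by (rule phi_inv) (auto intro!: continuous_map_real_mult continuous_phi)

lemma phi_Exp [simp]: "p \<in> X \<Longrightarrow> \<phi> (Exp x) p = exp (\<phi> x p)"
proof -
  assume p: "p \<in> X"
  have "continuous_map K euclideanreal (exp \<circ> \<phi> x)"
    by (rule continuous_map_compose[OF continuous_phi]) (simp add: continuous_on_exp)
  then show ?thesis
    unfolding yosida_exp_def using p by (intro phi_inv) (auto simp: o_def)
qed

lemma phi_log:
  assumes "\<And>p. p \<in> X \<Longrightarrow> \<phi> x p > 0" "p \<in> X"
  shows "\<phi> (yosida_log K \<phi> x) p = ln (\<phi> x p)"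
proof -
  have "continuous_map K (top_of_set {0<..}) (\<phi> x)"
    using assms(1) continuous_phi by (auto simp: continuous_map_in_subtopology)
  moreover have "continuous_map (top_of_set {0<..}) euclideanreal ln"
    by (auto intro!: continuous_intros)
  ultimately have "continuous_map K euclideanreal (ln \<circ> \<phi> x)"
    by (rule continuous_map_compose)
  then show ?thesis
    unfolding yosida_log_def using assms(2) by (intro phi_inv) (auto simp: o_def)
qed

lemma phi_bounded: obtains b where "\<And>p. p \<in> X \<Longrightarrow> \<bar>\<phi> x p\<bar> \<le> b"
proof -
  obtain b where "\<bar>x\<bar> \<le> b *\<^sub>R u" using unit by (auto simp: strong_order_unit_def)
  then have "\<And>p. p \<in> X \<Longrightarrow> \<bar>\<phi> x p\<bar> \<le> b" by (simp add: phi_le_iff)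
  then show ?thesis by (rule that)
qed

lemma phi_le_gauge_norm:
  assumes "p \<in> X"
  shows "\<phi> x p \<le> gauge_norm u x"
  unfolding gauge_norm_def
proof (rule cInf_greatest)
  show "{\<beta>. \<bar>x\<bar> \<le> \<beta> *\<^sub>R u} \<noteq> {}" using unit by (auto simp: strong_order_unit_def)
  show "\<phi> x p \<le> b" if "b \<in> {\<beta>. \<bar>x\<bar> \<le> \<beta> *\<^sub>R u}" for b
    using that assms by (fastforce simp: phi_le_iff)
qed

definition unit_closed :: "'a set \<Rightarrow> bool" where
  "unit_closed A \<longleftrightarrow> (\<forall>x. (\<forall>\<epsilon>>0. \<exists>y\<in>A. \<forall>p\<in>X. \<bar>\<phi> x p - \<phi> y p\<bar> \<le> \<epsilon>) \<longrightarrow> x \<in> A)"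

definition unit_bounded :: "('a \<Rightarrow> 'a) \<Rightarrow> bool" where
  "unit_bounded L \<longleftrightarrow>
     (\<exists>C. \<forall>x \<epsilon>. (\<forall>p\<in>X. \<bar>\<phi> x p\<bar> \<le> \<epsilon>) \<longrightarrow> (\<forall>p\<in>X. \<bar>\<phi> (L x) p\<bar> \<le> C * \<epsilon>))"

lemma unit_closed_singleton_0: "unit_closed {0}"
  unfolding unit_closed_def
proof (intro allI impI)
  fix x assume *: "\<forall>\<epsilon>>0. \<exists>y\<in>{0}. \<forall>p\<in>X. \<bar>\<phi> x p - \<phi> y p\<bar> \<le> \<epsilon>"
  have "\<phi> x p = 0" if "p \<in> X" for p
  proof -
    have "\<bar>\<phi> x p\<bar> \<le> \<epsilon>" if "\<epsilon> > 0" for \<epsilon>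
      using * that \<open>p \<in> X\<close> by fastforce
    then show ?thesis by (metis abs_le_zero_iff dense_ge)
  qed
  then show "x \<in> {0}" by (auto intro: phi_eqI)
qed

lemma unit_closed_vimage:
  assumes "linear L" "unit_bounded L" "unit_closed A"
  shows "unit_closed (L -` A)"
  unfolding unit_closed_def
proof (intro allI impI)
  fix x assume *: "\<forall>\<epsilon>>0. \<exists>y\<in>L -` A. \<forall>p\<in>X. \<bar>\<phi> x p - \<phi> y p\<bar> \<le> \<epsilon>"
  obtain C where C: "\<And>x \<epsilon> p. (\<And>p. p \<in> X \<Longrightarrow> \<bar>\<phi> x p\<bar> \<le> \<epsilon>) \<Longrightarrow> p \<in> X \<Longrightarrow> \<bar>\<phi> (L x) p\<bar> \<le> C * \<epsilon>"
    using assms(2) unfolding unit_bounded_def by blast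
  have "\<exists>y\<in>A. \<forall>p\<in>X. \<bar>\<phi> (L x) p - \<phi> y p\<bar> \<le> \<epsilon>" if \<epsilon>: "\<epsilon> > 0" for \<epsilon>
  proof -
    let ?\<delta> = "\<epsilon> / (\<bar>C\<bar> + 1)"
    have "?\<delta> > 0" using \<epsilon> by simp
    then obtain y where y: "L y \<in> A" "\<forall>p\<in>X. \<bar>\<phi> x p - \<phi> y p\<bar> \<le> ?\<delta>"
      using * by (metis vimageE)
    have "\<bar>\<phi> (L (x - y)) p\<bar> \<le> C * ?\<delta>" if "p \<in> X" for p
      using C[of "x - y" ?\<delta> p] y(2) that by simp
    moreover have "C * ?\<delta> \<le> \<epsilon>"
    proof -
      have "C * \<epsilon> \<le> (\<bar>C\<bar> + 1) * \<epsilon>" using \<epsilon> by (intro mult_right_mono) auto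
      then show ?thesis by (simp add: field_simps)
    qed
    ultimately show ?thesis
      using y(1) by (intro bexI[of _ "L y"]) (auto simp: linear_diff[OF assms(1)] intro: order_trans)
  qed
  then have "L x \<in> A" using assms(3) unfolding unit_closed_def by blast
  then show "x \<in> L -` A" by simp
qed

lemma unit_bounded_mult: "unit_bounded (\<lambda>x. x \<star> y)"
proof -
  obtain b where b: "\<And>p. p \<in> X \<Longrightarrow> \<bar>\<phi> y p\<bar> \<le> b" using phi_bounded by blast
  show ?thesis
    unfolding unit_bounded_def
  proof (intro exI[of _ b] allI impI ballI)
    fix x \<epsilon> p assume "\<forall>p\<in>X. \<bar>\<phi> x p\<bar> \<le> \<epsilon>" "p \<in> X"
    moreover from this have "\<bar>\<phi> x p\<bar> * \<bar>\<phi> y p\<bar> \<le> \<epsilon> * b"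
      using b by (intro mult_mono) (auto intro: order_trans[OF abs_ge_zero])
    ultimately show "\<bar>\<phi> (x \<star> y) p\<bar> \<le> b * \<epsilon>" by (simp add: abs_mult mult.commute)
  qed
qed

lemma unit_bounded_compose:
  assumes "unit_bounded L" "unit_bounded M"
  shows "unit_bounded (\<lambda>x. L (M x))"
proof -
  obtain C where C: "\<And>x \<epsilon>. (\<forall>p\<in>X. \<bar>\<phi> x p\<bar> \<le> \<epsilon>) \<Longrightarrow> \<forall>p\<in>X. \<bar>\<phi> (L x) p\<bar> \<le> C * \<epsilon>"
    using assms(1) unfolding unit_bounded_def by blast
  obtain D where D: "\<And>x \<epsilon>. (\<forall>p\<in>X. \<bar>\<phi> x p\<bar> \<le> \<epsilon>) \<Longrightarrow> \<forall>p\<in>X. \<bar>\<phi> (M x) p\<bar> \<le> D * \<epsilon>"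
    using assms(2) unfolding unit_bounded_def by blast
  show ?thesis
    unfolding unit_bounded_def using C[OF D] by (metis mult.assoc)
qed

lemma unit_bounded_diff:
  assumes "unit_bounded L" "unit_bounded M"
  shows "unit_bounded (\<lambda>x. L x - M x)"
proof -
  obtain C where C: "\<And>x \<epsilon>. (\<forall>p\<in>X. \<bar>\<phi> x p\<bar> \<le> \<epsilon>) \<Longrightarrow> \<forall>p\<in>X. \<bar>\<phi> (L x) p\<bar> \<le> C * \<epsilon>"
    using assms(1) unfolding unit_bounded_def by blast
  obtain D where D: "\<And>x \<epsilon>. (\<forall>p\<in>X. \<bar>\<phi> x p\<bar> \<le> \<epsilon>) \<Longrightarrow> \<forall>p\<in>X. \<bar>\<phi> (M x) p\<bar> \<le> D * \<epsilon>"
    using assms(2) unfolding unit_bounded_def by blast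
  show ?thesis
    unfolding unit_bounded_def
  proof (intro exI[of _ "C + D"] allI impI ballI)
    fix x \<epsilon> p assume *: "\<forall>p\<in>X. \<bar>\<phi> x p\<bar> \<le> \<epsilon>" "p \<in> X"
    then have "\<bar>\<phi> (L x) p\<bar> \<le> C * \<epsilon>" "\<bar>\<phi> (M x) p\<bar> \<le> D * \<epsilon>"
      using C D by blast+
    then show "\<bar>\<phi> (L x - M x) p\<bar> \<le> (C + D) * \<epsilon>"
      using *(2) by (simp add: distrib_right)
  qed
qed

lemma linear_mult: "linear (\<lambda>x. x \<star> y)"
  by (rule linearI) (auto intro!: phi_eqI simp: algebra_simps)

lemma mult_commute: "x \<star> y = y \<star> x"
  by (rule phi_eqI) simp

lemma order_convergent_to_unit_limit:
  assumes "\<And>n. \<forall>p\<in>X. \<bar>\<phi> x p - \<phi> (y n) p\<bar> \<le> inverse (real (Suc n))"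
  shows "order_convergent_to (filtermap y sequentially) x"
  unfolding order_convergent_to_def
proof (intro exI[of _ "range (\<lambda>n. inverse (real (Suc n)) *\<^sub>R u)"] conjI ballI)
  let ?D = "range (\<lambda>n. inverse (real (Suc n)) *\<^sub>R u)"
  have pos: "0 \<le> d" if "d \<in> ?D" for d
    using that by (auto simp: phi_le_iff)
  show "?D \<noteq> {}" by simp
  show bdd: "bdd_below ?D" using pos by (intro bdd_belowI[of _ 0]) auto
  have mono: "inverse (real (Suc m)) *\<^sub>R u \<le> inverse (real (Suc n)) *\<^sub>R u" if "n \<le> m" for m n
    using that by (auto simp: phi_le_iff field_simps)
  show "\<exists>c\<in>?D. c \<le> a \<and> c \<le> b" if ab: "a \<in> ?D" "b \<in> ?D" for a b
  proof -
    obtain m n where "a = inverse (real (Suc m)) *\<^sub>R u" "b = inverse (real (Suc n)) *\<^sub>R u"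
      using ab by blast
    then show ?thesis
      using mono[of m "max m n"] mono[of n "max m n"]
      by (intro bexI[of _ "inverse (real (Suc (max m n))) *\<^sub>R u"]) auto
  qed
  show "Inf ?D = 0"
  proof (rule antisym)
    show "0 \<le> Inf ?D" using pos by (intro cInf_greatest) auto
    have "\<phi> (Inf ?D) p \<le> 0" if "p \<in> X" for p
    proof (rule ccontr)
      assume "\<not> ?thesis"
      then obtain n where n: "inverse (real (Suc n)) < \<phi> (Inf ?D) p"
        using reals_Archimedean by (meson not_le)
      have "Inf ?D \<le> inverse (real (Suc n)) *\<^sub>R u" using bdd by (intro cInf_lower) blast+
      then have "\<phi> (Inf ?D) p \<le> inverse (real (Suc n))" using that phi_le_iff by simp
      with n show False by simp
    qed
    then show "Inf ?D \<le> 0" by (simp add: phi_le_iff)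
  qed
  show "eventually (\<lambda>z. \<bar>z - x\<bar> \<le> d) (filtermap y sequentially)" if d: "d \<in> ?D" for d
  proof -
    obtain n where n: "d = inverse (real (Suc n)) *\<^sub>R u" using d by blast
    have "\<bar>y m - x\<bar> \<le> d" if "m \<ge> n" for m
    proof -
      have "\<bar>y m - x\<bar> \<le> inverse (real (Suc m)) *\<^sub>R u"
        using assms[of m] by (auto simp: phi_le_iff abs_minus_commute)
      then show ?thesis using mono[OF that] n by simp
    qed
    then show ?thesis unfolding eventually_filtermap eventually_sequentially by blast
  qed
qed

lemma order_closed_imp_unit_closed:
  assumes "order_closed A"
  shows "unit_closed A"
  unfolding unit_closed_def
proof (intro allI impI)
  fix x assume "\<forall>\<epsilon>>0. \<exists>y\<in>A. \<forall>p\<in>X. \<bar>\<phi> x p - \<phi> y p\<bar> \<le> \<epsilon>"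
  then have "\<exists>y\<in>A. \<forall>p\<in>X. \<bar>\<phi> x p - \<phi> y p\<bar> \<le> inverse (real (Suc n))" for n by simp
  then obtain y where y: "\<And>n. y n \<in> A" "\<And>n. \<forall>p\<in>X. \<bar>\<phi> x p - \<phi> (y n) p\<bar> \<le> inverse (real (Suc n))"
    by metis
  have "eventually (\<lambda>z. z \<in> A) (filtermap y sequentially)"
    using y(1) by (auto simp: eventually_filtermap)
  then show "x \<in> A"
    using assms order_convergent_to_unit_limit[OF y(2)]
    unfolding order_closed_def by (metis filtermap_bot_iff trivial_limit_sequentially)
qed

subsection \<open>Components of the unit\<close>

definition unit_component :: "'a \<Rightarrow> bool" where
  "unit_component e \<longleftrightarrow> (\<forall>p\<in>X. \<phi> e p = 0 \<or> \<phi> e p = 1)"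

definition spectral_component :: "'a \<Rightarrow> 'a" where
  "spectral_component g = Sup (range (\<lambda>n. inf u (real n *\<^sub>R pprt g)))"

lemma bdd_above_spectral: "bdd_above (range (\<lambda>n. inf u (real n *\<^sub>R pprt g)))"
  by (rule bdd_aboveI[of _ u]) auto

lemma incseq_spectral: "incseq (\<lambda>n. inf u (real n *\<^sub>R pprt g))"
  unfolding incseq_def phi_le_iff
proof (intro allI impI ballI)
  fix m n :: nat and p assume "m \<le> n" "p \<in> X"
  then show "\<phi> (inf u (real m *\<^sub>R pprt g)) p \<le> \<phi> (inf u (real n *\<^sub>R pprt g)) p"
    using mult_right_mono[of "real m" "real n" "max (\<phi> g p) 0"] by auto
qed

lemma spectral_component_upper: "inf u (real n *\<^sub>R pprt g) \<le> spectral_component g"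
  unfolding spectral_component_def using bdd_above_spectral by (intro cSup_upper) auto

lemma spectral_component_least:
  "(\<And>n. inf u (real n *\<^sub>R pprt g) \<le> w) \<Longrightarrow> spectral_component g \<le> w"
  unfolding spectral_component_def by (intro cSup_least) auto

lemma spectral_component_in:
  assumes "order_closed A" "\<And>n. inf u (real n *\<^sub>R pprt g) \<in> A"
  shows "spectral_component g \<in> A"
  unfolding spectral_component_def
  using assms incseq_spectral bdd_above_spectral by (intro order_closed_Sup_incseq) auto

lemma spectral_component_pos:
  assumes "p \<in> X" "\<phi> g p > 0"
  shows "\<phi> (spectral_component g) p \<ge> 1"
proof -
  obtain n where "1 < real n * \<phi> g p" using reals_Archimedean3[OF assms(2)] by blast
  moreover have "\<phi> (inf u (real n *\<^sub>R pprt g)) p \<le> \<phi> (spectral_component g) p"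
    using spectral_component_upper assms(1) phi_le_iff by blast
  ultimately show ?thesis using assms by simp
qed

lemma spectral_component_bounds:
  assumes "p \<in> X"
  shows "0 \<le> \<phi> (spectral_component g) p" "\<phi> (spectral_component g) p \<le> 1"
proof -
  show "0 \<le> \<phi> (spectral_component g) p"
    using spectral_component_upper[of 0 g] assms by (auto simp: phi_le_iff)
  have "spectral_component g \<le> u" by (rule spectral_component_least) simp
  then show "\<phi> (spectral_component g) p \<le> 1" using assms by (auto simp: phi_le_iff)
qed

text \<open>
  Suprema are not computed pointwise in \<open>C(K)\<close>, so the values of the spectral component \<open>e\<close> are
  found by testing it against upper bounds: here \<open>max (e / 2) (2 e - 1)\<close>, and in the next lemma
  a continuous cutoff that vanishes at the given point.
\<close>

lemma unit_component_spectral: "unit_component (spectral_component g)"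
proof -
  let ?e = "spectral_component g"
  let ?w = "sup ((1/2) *\<^sub>R ?e) (2 *\<^sub>R ?e - u)"
  have "?e \<le> ?w"
  proof (rule spectral_component_least)
    fix n
    have *: "inf u (real (2 * n) *\<^sub>R pprt g) \<le> ?e" by (rule spectral_component_upper)
    show "inf u (real n *\<^sub>R pprt g) \<le> ?w"
      unfolding phi_le_iff
    proof
      fix p assume p: "p \<in> X"
      have "min 1 (2 * real n * max (\<phi> g p) 0) \<le> \<phi> ?e p"
        using * p by (auto simp: phi_le_iff)
      then show "\<phi> (inf u (real n *\<^sub>R pprt g)) p \<le> \<phi> ?w p"
        using p spectral_component_bounds[OF p, of g] by (auto simp: min_def max_def split: if_splits)
    qed
  qed
  then have le: "\<phi> ?e p \<le> max (\<phi> ?e p / 2) (2 * \<phi> ?e p - 1)" if "p \<in> X" for p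
    using that by (auto simp: phi_le_iff)
  have "\<phi> ?e p = 0 \<or> \<phi> ?e p = 1" if "p \<in> X" for p
    using le[OF that] spectral_component_bounds[OF that, of g] by (auto simp: max_def split: if_splits)
  then show ?thesis by (simp add: unit_component_def)
qed

lemma spectral_component_neg:
  assumes p: "p \<in> X" and neg: "\<phi> g p < 0"
  shows "\<phi> (spectral_component g) p = 0"
proof -
  let ?w = "pprt (u - (1 / - \<phi> g p) *\<^sub>R pprt (- g))"
  have "spectral_component g \<le> ?w"
  proof (rule spectral_component_least)
    fix n
    show "inf u (real n *\<^sub>R pprt g) \<le> ?w"
      unfolding phi_le_iff by (auto simp: max_def min_def)
  qed
  then have "\<phi> (spectral_component g) p \<le> \<phi> ?w p" using p phi_le_iff by blast
  also have "\<phi> ?w p = 0" using p neg by simp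
  finally show ?thesis using spectral_component_bounds(1)[OF p, of g] by simp
qed

lemma unit_component_unit: "unit_component u"
  by (simp add: unit_component_def)

text \<open>The uniform form of Freudenthal's spectral theorem.\<close>

lemma closed_riesz_subspace_subset:
  assumes E: "closed_riesz_subspace E" "u \<in> E"
    and A: "subspace A" "unit_closed A"
    and comp: "\<And>e. e \<in> E \<Longrightarrow> unit_component e \<Longrightarrow> e \<in> A"
  shows "E \<subseteq> A"
proof
  fix g assume g: "g \<in> E"
  have sub: "subspace E" and lat: "\<And>x y. x \<in> E \<Longrightarrow> y \<in> E \<Longrightarrow> sup x y \<in> E \<and> inf x y \<in> E"
    and cl: "order_closed E"
    using E(1) unfolding closed_riesz_subspace_def riesz_subspace_def by blast+
  obtain b where b: "\<And>p. p \<in> X \<Longrightarrow> \<bar>\<phi> g p\<bar> \<le> b" using phi_bounded by blast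
  have "\<exists>y\<in>A. \<forall>p\<in>X. \<bar>\<phi> g p - \<phi> y p\<bar> \<le> \<delta>" if \<delta>: "\<delta> > 0" for \<delta>
  proof -
    define e where "e k = spectral_component (g + (b - real k * \<delta>) *\<^sub>R u)" for k
    obtain m where m: "2 * b \<le> real m * \<delta>"
      using reals_Archimedean3[OF \<delta>] less_imp_le by blast
    have "e k \<in> E" for k
      unfolding e_def
    proof (rule spectral_component_in[OF cl])
      fix n
      have "g + (b - real k * \<delta>) *\<^sub>R u \<in> E"
        using g E(2) sub by (intro subspace_add subspace_scale)
      then have "pprt (g + (b - real k * \<delta>) *\<^sub>R u) \<in> E"
        unfolding pprt_def using lat subspace_0[OF sub] by blast
      then show "inf u (real n *\<^sub>R pprt (g + (b - real k * \<delta>) *\<^sub>R u)) \<in> E"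
        using lat E(2) subspace_scale[OF sub] by blast
    qed
    then have eA: "e k \<in> A" for k
      using comp unit_component_spectral e_def by metis
    let ?y = "\<delta> *\<^sub>R (\<Sum>k<m. e k) - b *\<^sub>R u"
    have uA: "u \<in> A" using comp E(2) unit_component_unit by blast
    have "?y \<in> A"
      using eA uA A(1) by (intro subspace_diff subspace_scale subspace_sum) auto
    moreover have "\<bar>\<phi> g p - \<phi> ?y p\<bar> \<le> \<delta>" if p: "p \<in> X" for p
    proof -
      define G where "G = (\<phi> g p + b) / \<delta>"
      have G0: "0 \<le> G" using b[OF p] \<delta> by (auto simp: G_def)
      have e01: "\<phi> (e k) p = 0 \<or> \<phi> (e k) p = 1" for k
        using unit_component_spectral p unfolding e_def unit_component_def by blast
      have val: "\<phi> (g + (b - real k * \<delta>) *\<^sub>R u) p = (G - real k) * \<delta>" for k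
        using p \<delta> by (simp add: G_def field_simps)
      have e1: "G \<le> real k" if "\<phi> (e k) p = 0" for k
      proof (rule ccontr)
        assume "\<not> G \<le> real k"
        then have "\<phi> (e k) p \<ge> 1"
          unfolding e_def using p \<delta> by (intro spectral_component_pos) (simp_all only: val, simp)
        with that show False by simp
      qed
      have e0: "real k \<le> G" if "\<phi> (e k) p = 1" for k
      proof (rule ccontr)
        assume "\<not> real k \<le> G"
        then have "\<phi> (e k) p = 0"
          unfolding e_def using p \<delta>
          by (intro spectral_component_neg) (simp_all only: val, simp add: mult_neg_pos)
        with that show False by simp
      qed
      have "min G (real j) \<le> (\<Sum>k<j. \<phi> (e k) p) \<and> (\<Sum>k<j. \<phi> (e k) p) \<le> min (real j) (G + 1)" for j
      proof (induction j)
        case 0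
        then show ?case using G0 by simp
      next
        case (Suc j)
        then show ?case using e01[of j] e0[of j] e1[of j] by auto
      qed
      moreover have "G \<le> real m"
        using m b[OF p] \<delta> by (auto simp: G_def field_simps)
      ultimately have "\<bar>G - (\<Sum>k<m. \<phi> (e k) p)\<bar> \<le> 1" by (smt (verit))
      then have "\<bar>G - (\<Sum>k<m. \<phi> (e k) p)\<bar> * \<delta> \<le> 1 * \<delta>"
        using \<delta> by (intro mult_right_mono) auto
      moreover have "\<phi> g p - \<phi> ?y p = (G - (\<Sum>k<m. \<phi> (e k) p)) * \<delta>"
        using p \<delta> by (simp add: G_def field_simps)
      ultimately show ?thesis using \<delta> by (simp add: abs_mult)
    qed
    ultimately show ?thesis by blast
  qed
  then show "g \<in> A" using A(2) unfolding unit_closed_def by blast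
qed

lemma closed_riesz_subspace_unit_closed: "closed_riesz_subspace E \<Longrightarrow> unit_closed E"
  by (simp add: closed_riesz_subspace_def order_closed_imp_unit_closed)

lemma closed_riesz_subspace_subspace: "closed_riesz_subspace E \<Longrightarrow> subspace E"
  by (simp add: closed_riesz_subspace_def riesz_subspace_def)

lemma closed_riesz_subspace_mult:
  assumes E: "closed_riesz_subspace E" "u \<in> E" and xy: "x \<in> E" "y \<in> E"
  shows "x \<star> y \<in> E"
proof -
  have vimage: "subspace ((\<lambda>x. x \<star> y) -` E)" "unit_closed ((\<lambda>x. x \<star> y) -` E)" for y
    using linear_subspace_vimage[OF linear_mult closed_riesz_subspace_subspace[OF E(1)]]
      unit_closed_vimage[OF linear_mult unit_bounded_mult closed_riesz_subspace_unit_closed[OF E(1)]]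
    by blast+
  have comp: "e \<star> f \<in> E" if "e \<in> E" "f \<in> E" "unit_component e" "unit_component f" for e f
  proof -
    have "e \<star> f = inf e f"
      using that(3,4) by (intro phi_eqI) (force simp: unit_component_def)
    then show ?thesis
      using that(1,2) E(1) by (auto simp: closed_riesz_subspace_def riesz_subspace_def)
  qed
  have "E \<subseteq> (\<lambda>x. x \<star> e) -` E" if "e \<in> E" "unit_component e" for e
    using comp that by (intro closed_riesz_subspace_subset E vimage) auto
  then have "E \<subseteq> (\<lambda>x. x \<star> y) -` E"
    using xy(2) by (intro closed_riesz_subspace_subset E vimage) (auto simp: mult_commute)
  then show ?thesis using xy(1) by blast
qed

lemma closed_riesz_subspace_Exp:
  assumes E: "closed_riesz_subspace E" "u \<in> E" and x: "x \<in> E"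
  shows "Exp x \<in> E"
proof -
  obtain b where b: "\<And>p. p \<in> X \<Longrightarrow> \<bar>\<phi> x p\<bar> \<le> b" using phi_bounded by blast
  define c where "c = max b 0"
  have c: "\<bar>\<phi> x p\<bar> \<le> c" if "p \<in> X" for p using b[OF that] by (simp add: c_def)
  define pw where "pw n = ((\<lambda>z. z \<star> x) ^^ n) u" for n
  have pwE: "pw n \<in> E" for n
    by (induction n) (auto simp: pw_def E x intro!: closed_riesz_subspace_mult)
  have pw: "\<phi> (pw n) p = \<phi> x p ^ n" if "p \<in> X" for n p
    by (induction n) (auto simp: pw_def that)
  have "\<exists>y\<in>E. \<forall>p\<in>X. \<bar>\<phi> (Exp x) p - \<phi> y p\<bar> \<le> \<epsilon>" if \<epsilon>: "\<epsilon> > 0" for \<epsilon>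
  proof -
    have "(\<lambda>n. exp c * (inverse (fact n) * c ^ n)) \<longlonglongrightarrow> 0"
      by (intro tendsto_mult_right_zero summable_LIMSEQ_zero summable_exp)
    then have "eventually (\<lambda>n. exp c * (inverse (fact n) * c ^ n) < \<epsilon>) sequentially"
      using \<epsilon> by (rule order_tendstoD(2))
    then obtain n where n: "exp c * (inverse (fact n) * c ^ n) < \<epsilon>"
      by (auto simp: eventually_sequentially)
    let ?y = "\<Sum>m<n. inverse (fact m) *\<^sub>R pw m"
    have "?y \<in> E"
      using pwE E(1) by (intro subspace_sum subspace_scale closed_riesz_subspace_subspace)
    moreover have "\<bar>\<phi> (Exp x) p - \<phi> ?y p\<bar> \<le> \<epsilon>" if p: "p \<in> X" for p
    proof -
      obtain t where t: "\<bar>t\<bar> \<le> \<bar>\<phi> x p\<bar>"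
        "exp (\<phi> x p) = (\<Sum>m<n. \<phi> x p ^ m / fact m) + exp t / fact n * \<phi> x p ^ n"
        using Maclaurin_exp_le[of "\<phi> x p" n] by blast
      have "\<bar>\<phi> (Exp x) p - \<phi> ?y p\<bar> = \<bar>exp t / fact n * \<phi> x p ^ n\<bar>"
        using p t(2) by (simp add: pw divide_inverse mult.commute)
      also have "\<dots> = exp t * (inverse (fact n) * \<bar>\<phi> x p\<bar> ^ n)"
        by (simp add: abs_mult power_abs divide_inverse)
      also have "\<dots> \<le> exp c * (inverse (fact n) * c ^ n)"
        using c[OF p] t(1) by (intro mult_mono power_mono) auto
      finally show ?thesis using n by simp
    qed
    ultimately show ?thesis by blast
  qed
  then show ?thesis
    using closed_riesz_subspace_unit_closed[OF E(1)] unfolding unit_closed_def by blast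
qed

subsection \<open>Band projections\<close>

lemma disjoint_iff: "inf \<bar>x\<bar> \<bar>y\<bar> = 0 \<longleftrightarrow> (\<forall>p\<in>X. \<phi> x p = 0 \<or> \<phi> y p = 0)"
proof -
  have "inf \<bar>x\<bar> \<bar>y\<bar> = 0 \<longleftrightarrow> (\<forall>p\<in>X. \<phi> (inf \<bar>x\<bar> \<bar>y\<bar>) p = \<phi> 0 p)"
    using phi_eqI by metis
  also have "\<dots> \<longleftrightarrow> (\<forall>p\<in>X. \<phi> x p = 0 \<or> \<phi> y p = 0)"
    by (auto simp: min_def)
  finally show ?thesis .
qed

lemma band_proj_eqI:
  fixes B :: "'a set"
  assumes B: "subspace B" and y: "y \<in> B" "x - y \<in> disjoint_complement B"
  shows "band_proj B x = y"
  unfolding band_proj_def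
proof (rule the_equality)
  show "y \<in> B \<and> x - y \<in> disjoint_complement B" using y by blast
  fix z assume z: "z \<in> B \<and> x - z \<in> disjoint_complement B"
  then have "y - z \<in> B" using B y(1) by (simp add: subspace_diff)
  then have "inf \<bar>x - y\<bar> \<bar>y - z\<bar> = 0" "inf \<bar>x - z\<bar> \<bar>y - z\<bar> = 0"
    using y(2) z by (auto simp: disjoint_complement_def)
  then have "\<phi> z p = \<phi> y p" if "p \<in> X" for p
    using that unfolding disjoint_iff by fastforce
  then show "z = y" by (rule phi_eqI)
qed

lemma band_vanishing:
  assumes e: "unit_component e"
  shows "band {x. \<forall>p\<in>X. \<phi> e p = 0 \<longrightarrow> \<phi> x p = 0}" (is "band ?B")
proof -
  have "order_closed ?B"
    unfolding order_closed_def
  proof (intro allI impI)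
    fix F x
    assume *: "F \<noteq> bot \<and> eventually (\<lambda>y. y \<in> ?B) F \<and> order_convergent_to F x"
    then obtain D where D: "D \<noteq> {}" "Inf D = 0" "\<And>d. d \<in> D \<Longrightarrow> eventually (\<lambda>z. \<bar>z - x\<bar> \<le> d) F"
      unfolding order_convergent_to_def by blast
    have "(u - e) \<star> \<bar>x\<bar> \<le> d" if d: "d \<in> D" for d
    proof -
      have "eventually (\<lambda>z. z \<in> ?B \<and> \<bar>z - x\<bar> \<le> d) F"
        using * D(3)[OF d] by (simp only: eventually_conj)
      then obtain z where z: "z \<in> ?B" "\<bar>z - x\<bar> \<le> d"
        using * eventually_happens' by blast
      show ?thesis
        unfolding phi_le_iff
      proof
        fix p assume p: "p \<in> X"
        have "\<bar>\<phi> z p - \<phi> x p\<bar> \<le> \<phi> d p" using z(2) p by (simp add: phi_le_iff)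
        then show "\<phi> ((u - e) \<star> \<bar>x\<bar>) p \<le> \<phi> d p"
          using e p z(1) unfolding unit_component_def by fastforce
      qed
    qed
    then have "(u - e) \<star> \<bar>x\<bar> \<le> 0"
      using D(1) by (subst D(2)[symmetric]) (auto intro: cInf_greatest)
    then show "x \<in> ?B" by (auto simp: phi_le_iff)
  qed
  moreover have "subspace ?B" by (auto simp: subspace_def)
  moreover have "y \<in> ?B" if "x \<in> ?B" "\<bar>y\<bar> \<le> \<bar>x\<bar>" for x y
    using that by (fastforce simp: phi_le_iff)
  ultimately show ?thesis unfolding band_def by blast
qed

lemma unit_component_band_projection:
  assumes "unit_component e"
  obtains P where "is_band_projection P" "\<And>x. P x = e \<star> x"
proof
  let ?B = "{x. \<forall>p\<in>X. \<phi> e p = 0 \<longrightarrow> \<phi> x p = 0}"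
  show "is_band_projection (band_proj ?B)"
    unfolding is_band_projection_def using band_vanishing[OF assms] by blast
  show "band_proj ?B x = e \<star> x" for x
  proof (rule band_proj_eqI)
    show "subspace ?B" using band_vanishing[OF assms] by (simp add: band_def)
    show "e \<star> x \<in> ?B" by simp
    show "x - e \<star> x \<in> disjoint_complement ?B"
      using assms by (auto simp: disjoint_complement_def disjoint_iff unit_component_def)
  qed
qed

lemma band_proj_principal_unit: "band_proj (band hull {pprt g}) u = spectral_component g"
proof (rule band_proj_eqI)
  let ?e = "spectral_component g"
  have B: "band (band hull {pprt g})" by (rule band_hull)
  show "subspace (band hull {pprt g})" using B by (simp add: band_def)
  show "?e \<in> band hull {pprt g}"
  proof (rule spectral_component_in)
    show "order_closed (band hull {pprt g})" using B by (simp add: band_def)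
    fix n
    have "pprt g \<in> band hull {pprt g}" by (simp add: hull_inc)
    then have "real n *\<^sub>R pprt g \<in> band hull {pprt g}"
      using B by (simp add: band_def subspace_scale)
    moreover have "\<bar>inf u (real n *\<^sub>R pprt g)\<bar> \<le> \<bar>real n *\<^sub>R pprt g\<bar>"
      by (auto simp: phi_le_iff min_def)
    ultimately show "inf u (real n *\<^sub>R pprt g) \<in> band hull {pprt g}"
      using B unfolding band_def by blast
  qed
  have "pprt g \<in> {x. \<forall>p\<in>X. \<phi> ?e p = 0 \<longrightarrow> \<phi> x p = 0}"
    using spectral_component_pos[of _ g] by (force simp: max_def)
  then have "band hull {pprt g} \<subseteq> {x. \<forall>p\<in>X. \<phi> ?e p = 0 \<longrightarrow> \<phi> x p = 0}"
    by (intro hull_minimal band_vanishing unit_component_spectral) auto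
  then show "u - ?e \<in> disjoint_complement (band hull {pprt g})"
    using unit_component_spectral[of g]
    by (fastforce simp: disjoint_complement_def disjoint_iff unit_component_def)
qed

end

subsection \<open>Conditional expectations\<close>

locale yosida_expectation = yosida_space u K \<phi>
  for u :: "'a::dedekind_complete_riesz_space" and K :: "'k topology" and \<phi> :: "'a \<Rightarrow> 'k \<Rightarrow> real" +
  fixes T :: "'a \<Rightarrow> 'a"
  assumes expectation: "conditional_expectation T" and T_unit: "T u = u"
begin

lemma linear_T: "linear T"
  using expectation by (simp add: conditional_expectation_def)

lemmas T_simps = linear_add[OF linear_T] linear_diff[OF linear_T] linear_scale[OF linear_T]
  linear_0[OF linear_T]

lemma T_T: "T (T x) = T x"
  using expectation by (simp add: conditional_expectation_def)

lemma T_mono: "x \<le> y \<Longrightarrow> T x \<le> T y"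
  using expectation T_simps(2)[of y x] unfolding conditional_expectation_def
  by (metis diff_ge_0_iff_ge)

lemma range_T: "closed_riesz_subspace (range T)" "u \<in> range T"
proof -
  show "closed_riesz_subspace (range T)"
    using expectation order_closed_range_projection[OF _ T_T]
    by (simp add: conditional_expectation_def dedekind_complete_subspace_def closed_riesz_subspace_def)
  show "u \<in> range T" using T_unit by (metis rangeI)
qed

lemma phi_T_bound:
  assumes "\<And>p. p \<in> X \<Longrightarrow> \<bar>\<phi> x p\<bar> \<le> c * \<phi> y p" "p \<in> X"
  shows "\<bar>\<phi> (T x) p\<bar> \<le> c * \<phi> (T y) p"
proof -
  have "x \<le> c *\<^sub>R y" "- (c *\<^sub>R y) \<le> x"
    using assms(1) by (fastforce simp: phi_le_iff)+
  then have "T x \<le> c *\<^sub>R T y" "- (c *\<^sub>R T y) \<le> T x"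
    using T_mono[of x "c *\<^sub>R y"] T_mono[of "- (c *\<^sub>R y)" x]
    by (auto simp: T_simps linear_neg[OF linear_T])
  then show ?thesis using assms(2) by (fastforce simp: phi_le_iff)
qed

lemma unit_bounded_T: "unit_bounded T"
  unfolding unit_bounded_def
proof (intro exI[of _ 1] allI impI ballI)
  fix x \<epsilon> p assume "\<forall>p\<in>X. \<bar>\<phi> x p\<bar> \<le> \<epsilon>" "p \<in> X"
  then show "\<bar>\<phi> (T x) p\<bar> \<le> 1 * \<epsilon>"
    using phi_T_bound[of x \<epsilon> u p] T_unit by simp
qed

lemma averaging:
  assumes "x \<in> range T"
  shows "T (x \<star> y) = x \<star> T y"
proof -
  let ?L = "\<lambda>x. T (x \<star> y) - x \<star> T y"
  have lin: "linear ?L"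
    by (intro linear_compose_sub linear_mult linear_compose[OF linear_mult linear_T, unfolded o_def])
  have "range T \<subseteq> ?L -` {0}"
  proof (rule closed_riesz_subspace_subset[OF range_T])
    show "subspace (?L -` {0})" by (intro linear_subspace_vimage lin) simp
    show "unit_closed (?L -` {0})"
      by (intro unit_closed_vimage unit_closed_singleton_0 lin unit_bounded_diff unit_bounded_mult
          unit_bounded_compose[OF unit_bounded_T])
    fix e assume e: "e \<in> range T" "unit_component e"
    then have Te: "T e = e" using T_T by auto
    obtain b where b: "\<And>p. p \<in> X \<Longrightarrow> \<bar>\<phi> y p\<bar> \<le> b" using phi_bounded by blast
    have "\<phi> (T (e \<star> y)) p = \<phi> (e \<star> T y) p" if p: "p \<in> X" for p
    proof -
      have "\<bar>\<phi> (e \<star> y) q\<bar> \<le> b * \<phi> e q" "\<bar>\<phi> (y - e \<star> y) q\<bar> \<le> b * \<phi> (u - e) q"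
        if "q \<in> X" for q
        using e(2) b[OF that] that unfolding unit_component_def by fastforce+
      then have "\<bar>\<phi> (T (e \<star> y)) p\<bar> \<le> b * \<phi> e p" "\<bar>\<phi> (T (y - e \<star> y)) p\<bar> \<le> b * (1 - \<phi> e p)"
        using phi_T_bound[of "e \<star> y" b e p] phi_T_bound[of "y - e \<star> y" b "u - e" p] p
        by (auto simp: T_simps T_unit Te)
      then show ?thesis
        using e(2) p unfolding unit_component_def by (fastforce simp: T_simps)
    qed
    then show "e \<in> ?L -` {0}" by (simp add: phi_eqI)
  qed
  then show ?thesis using assms by auto
qed

lemma indep_subspaces_mult:
  assumes E1: "closed_riesz_subspace E1" "u \<in> E1" and E2: "closed_riesz_subspace E2" "u \<in> E2"
    and indep: "indep_subspaces K \<phi> u T E1 E2"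
    and xy: "x \<in> E1" "y \<in> E2"
  shows "T (x \<star> y) = T x \<star> T y"
proof -
  let ?L = "\<lambda>y x. T (x \<star> y) - T x \<star> T y"
  have lin: "linear (?L y)" for y
    by (intro linear_compose_sub linear_compose[OF linear_mult linear_T, unfolded o_def]
        linear_compose[OF linear_T linear_mult, unfolded o_def])
  have vimage: "subspace (?L y -` {0})" "unit_closed (?L y -` {0})" for y
  proof -
    show "subspace (?L y -` {0})" by (intro linear_subspace_vimage lin) simp
    show "unit_closed (?L y -` {0})"
      by (intro unit_closed_vimage unit_closed_singleton_0 lin unit_bounded_diff unit_bounded_mult
          unit_bounded_compose[OF unit_bounded_T] unit_bounded_compose[OF unit_bounded_mult]
          unit_bounded_T)
  qed
  have comp: "?L f e = 0"
    if ef: "e \<in> E1" "f \<in> E2" "unit_component e" "unit_component f" for e f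
  proof -
    obtain P where P: "is_band_projection P" "\<And>x. P x = e \<star> x"
      using unit_component_band_projection ef(3) by blast
    obtain Q where Q: "is_band_projection Q" "\<And>x. Q x = f \<star> x"
      using unit_component_band_projection ef(4) by blast
    have unit: "z \<star> u = z" for z by (rule phi_eqI) simp
    then show ?thesis
      using indep P Q ef(1,2) unfolding indep_subspaces_def indep_projections_def by fastforce
  qed
  have "E1 \<subseteq> ?L f -` {0}" if "f \<in> E2" "unit_component f" for f
    using comp that by (intro closed_riesz_subspace_subset E1 vimage) auto
  then have "T (x \<star> f) = T x \<star> T f" if "f \<in> E2" "unit_component f" for f
    using that xy(1) by fastforce
  then have "T (f \<star> x) = T f \<star> T x" if "f \<in> E2" "unit_component f" for f
    using that by (simp add: mult_commute[of f x] mult_commute[of "T f" "T x"])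
  then have "E2 \<subseteq> ?L x -` {0}"
    by (intro closed_riesz_subspace_subset E2 vimage) auto
  then have "T (y \<star> x) = T y \<star> T x" using xy(2) by auto
  then show ?thesis by (simp add: mult_commute[of x y] mult_commute[of "T x" "T y"])
qed

lemma phi_T_Exp_pos:
  assumes "p \<in> X"
  shows "\<phi> (T (Exp x)) p > 0"
proof -
  obtain b where b: "\<And>p. p \<in> X \<Longrightarrow> \<bar>\<phi> x p\<bar> \<le> b" using phi_bounded by blast
  have "exp (- b) *\<^sub>R u \<le> Exp x" using b by (fastforce simp: phi_le_iff)
  then have "exp (- b) *\<^sub>R u \<le> T (Exp x)" using T_mono T_simps(3) T_unit by metis
  then have "exp (- b) \<le> \<phi> (T (Exp x)) p" using assms by (simp add: phi_le_iff)
  then show ?thesis by (meson exp_gt_zero less_le_trans)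
qed

lemma phi_T_Exp_sum:
  fixes f :: "nat \<Rightarrow> 'a"
  assumes indep: "indep_elements K \<phi> u T {1..n} f" and p: "p \<in> X" and "k \<le> n"
  shows "\<phi> (T (Exp (t *\<^sub>R (\<Sum>i=1..k. f i - T (f i))))) p =
    (\<Prod>i=1..k. \<phi> (T (Exp (t *\<^sub>R (f i - T (f i))))) p)"
  using \<open>k \<le> n\<close>
proof (induction k)
  case 0
  have "Exp 0 = u" by (rule phi_eqI) simp
  then show ?case using T_unit p by simp
next
  case (Suc k)
  define g where "g i = f i - T (f i)" for i
  show ?case
  proof (cases "k = 0")
    case True
    then show ?thesis by simp
  next
    case False
    let ?E = "\<lambda>i. closed_riesz_subspace hull ({f i} \<union> range T)"
    let ?H = "\<lambda>\<Lambda>. closed_riesz_subspace hull (\<Union>i\<in>\<Lambda>. ?E i)"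
    have H: "closed_riesz_subspace (?H \<Lambda>)" for \<Lambda> by (rule closed_riesz_subspace_hull)
    have fE: "f i \<in> ?E i" and TE: "T x \<in> ?E i" for i x by (auto intro: hull_inc)
    have EH: "?E i \<subseteq> ?H \<Lambda>" if "i \<in> \<Lambda>" for i \<Lambda>
      using that by (intro order_trans[OF _ hull_subset]) blast
    have fH: "f i \<in> ?H \<Lambda>" and TH: "T x \<in> ?H \<Lambda>" if "i \<in> \<Lambda>" for i x \<Lambda>
      using EH[OF that] fE TE by blast+
    have gH: "g i \<in> ?H \<Lambda>" if "i \<in> \<Lambda>" for i \<Lambda>
      unfolding g_def using fH[OF that] TH[OF that] closed_riesz_subspace_subspace[OF H]
      by (intro subspace_diff)
    have uH: "u \<in> ?H \<Lambda>" if "i \<in> \<Lambda>" for i \<Lambda>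
      using TH[OF that, of u] T_unit by simp
    have "Exp (t *\<^sub>R (\<Sum>i=1..k. g i)) \<in> ?H {1..k}"
      using False by (intro closed_riesz_subspace_Exp H uH[of 1] subspace_scale subspace_sum gH
          closed_riesz_subspace_subspace) auto
    moreover have "Exp (t *\<^sub>R g (Suc k)) \<in> ?H {Suc k}"
      by (intro closed_riesz_subspace_Exp H uH[of "Suc k"] subspace_scale gH
          closed_riesz_subspace_subspace) auto
    moreover have "indep_subspaces K \<phi> u T (?H {1..k}) (?H {Suc k})"
    proof -
      have "{1..k} \<subseteq> {1..n}" "{Suc k} \<subseteq> {1..n}" "{1..k} \<inter> {Suc k} = {}"
        using Suc.prems by auto
      then show ?thesis
        using indep unfolding indep_elements_def indep_family_def by blast
    qed
    ultimately have "T (Exp (t *\<^sub>R (\<Sum>i=1..k. g i)) \<star> Exp (t *\<^sub>R g (Suc k))) =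
        T (Exp (t *\<^sub>R (\<Sum>i=1..k. g i))) \<star> T (Exp (t *\<^sub>R g (Suc k)))"
      using False by (intro indep_subspaces_mult[OF H uH[of 1] H uH[of "Suc k"]]) auto
    moreover have "Exp (t *\<^sub>R (\<Sum>i=1..Suc k. g i)) =
        Exp (t *\<^sub>R (\<Sum>i=1..k. g i)) \<star> Exp (t *\<^sub>R g (Suc k))"
      by (rule phi_eqI) (simp add: exp_add[symmetric] distrib_left)
    ultimately show ?thesis
      using Suc p by (simp add: g_def)
  qed
qed

end

subsection \<open>Exponential moments\<close>

lemma exp_scaled_remainder_le:
  fixes t y :: real
  assumes t: "0 \<le> t" and y: "y \<le> 1"
  shows "exp (t * y) - t * y - 1 \<le> (exp t - t - 1) * y\<^sup>2"
proof -
  define G where "G s = (exp s - s - 1) * y\<^sup>2 - (exp (s * y) - s * y - 1)" for s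
  define G' where "G' s = (exp s - 1) * y\<^sup>2 - (exp (s * y) - 1) * y" for s
  have G: "(G has_real_derivative G' s) (at s)" for s
    unfolding G_def G'_def by (auto intro!: derivative_eq_intros simp: algebra_simps)
  have G': "(G' has_real_derivative (exp s - exp (s * y)) * y\<^sup>2) (at s)" for s
    unfolding G'_def by (auto intro!: derivative_eq_intros simp: algebra_simps power2_eq_square)
  have "G' 0 \<le> G' s" if s: "0 \<le> s" for s
  proof (rule DERIV_nonneg_imp_nondecreasing[OF s])
    fix r assume "0 \<le> r" "r \<le> s"
    then have "0 \<le> (exp r - exp (r * y)) * y\<^sup>2"
      using y by (intro mult_nonneg_nonneg) (auto simp: mult_left_le)
    then show "\<exists>d. (G' has_real_derivative d) (at r) \<and> 0 \<le> d" using G' by blast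
  qed
  then have "0 \<le> G' s" if "0 \<le> s" for s
    using that by (simp add: G'_def)
  then have "G 0 \<le> G t"
    using G by (intro DERIV_nonneg_imp_nondecreasing[OF t]) blast
  then show ?thesis by (simp add: G_def)
qed

context yosida_expectation
begin

lemma ln_T_Exp_le:
  assumes f: "f \<le> u" and t: "t > 0" and p: "p \<in> X"
  shows "ln (\<phi> (T (Exp (t *\<^sub>R (f - T f)))) p) \<le> (exp t - t - 1) * \<phi> (T (f \<star> f)) p"
proof -
  have "Exp (t *\<^sub>R (f - T f)) = Exp (- (t *\<^sub>R T f)) \<star> Exp (t *\<^sub>R f)"
    by (rule phi_eqI) (simp add: exp_add[symmetric] algebra_simps)
  moreover have "Exp (- (t *\<^sub>R T f)) \<in> range T"
    using rangeI[of T "- (t *\<^sub>R f)"]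
    by (intro closed_riesz_subspace_Exp range_T) (simp add: T_simps linear_neg[OF linear_T])
  ultimately have "\<phi> (T (Exp (t *\<^sub>R (f - T f)))) p = exp (- t * \<phi> (T f) p) * \<phi> (T (Exp (t *\<^sub>R f))) p"
    using p by (simp add: averaging)
  then have "ln (\<phi> (T (Exp (t *\<^sub>R (f - T f)))) p) = ln (\<phi> (T (Exp (t *\<^sub>R f))) p) - t * \<phi> (T f) p"
    using phi_T_Exp_pos[OF p, of "t *\<^sub>R f"] by (simp add: ln_mult)
  also have "\<dots> \<le> \<phi> (T (Exp (t *\<^sub>R f))) p - 1 - t * \<phi> (T f) p"
    using ln_le_minus_one[OF phi_T_Exp_pos[OF p, of "t *\<^sub>R f"]] by simp
  also have "\<dots> = \<phi> (T (Exp (t *\<^sub>R f) - u - t *\<^sub>R f)) p"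
    using p by (simp add: T_simps T_unit)
  also have "\<dots> \<le> \<phi> (T ((exp t - t - 1) *\<^sub>R (f \<star> f))) p"
  proof -
    have "Exp (t *\<^sub>R f) - u - t *\<^sub>R f \<le> (exp t - t - 1) *\<^sub>R (f \<star> f)"
      unfolding phi_le_iff
    proof
      fix q assume q: "q \<in> X"
      then have "\<phi> f q \<le> 1" using f by (auto simp: phi_le_iff)
      then show "\<phi> (Exp (t *\<^sub>R f) - u - t *\<^sub>R f) q \<le> \<phi> ((exp t - t - 1) *\<^sub>R (f \<star> f)) q"
        using exp_scaled_remainder_le[of t "\<phi> f q"] t q by (simp add: power2_eq_square)
    qed
    then show ?thesis using T_mono p phi_le_iff by blast
  qed
  finally show ?thesis using p by (simp add: T_simps)
qed

lemma ln_T_Exp_sum_le: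
  fixes f :: "nat \<Rightarrow> 'a"
  assumes "indep_elements K \<phi> u T {1..n} f" "\<And>i. i \<in> {1..n} \<Longrightarrow> f i \<le> u" "t > 0" "p \<in> X"
  shows "ln (\<phi> (T (Exp (t *\<^sub>R (\<Sum>i=1..n. f i - T (f i))))) p) \<le>
    (exp t - t - 1) * \<phi> (\<Sum>i=1..n. T (f i \<star> f i)) p"
proof -
  have "ln (\<phi> (T (Exp (t *\<^sub>R (\<Sum>i=1..n. f i - T (f i))))) p) =
      (\<Sum>i=1..n. ln (\<phi> (T (Exp (t *\<^sub>R (f i - T (f i))))) p))"
    unfolding phi_T_Exp_sum[OF assms(1,4) order.refl]
    by (rule ln_prod) (simp_all add: phi_T_Exp_pos[OF assms(4)] less_imp_neq[THEN not_sym])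
  also have "\<dots> \<le> (\<Sum>i=1..n. (exp t - t - 1) * \<phi> (T (f i \<star> f i)) p)"
    using assms by (intro sum_mono ln_T_Exp_le)
  finally show ?thesis
    using assms(4) by (simp add: sum_distrib_left)
qed

lemma T_spectral_component_le:
  assumes "t \<ge> 0" "p \<in> X"
  shows "\<phi> (T (spectral_component (S - x *\<^sub>R u))) p \<le> exp (- t * x) * \<phi> (T (Exp (t *\<^sub>R S))) p"
proof -
  let ?e = "spectral_component (S - x *\<^sub>R u)"
  have "?e \<le> exp (- t * x) *\<^sub>R Exp (t *\<^sub>R S)"
    unfolding phi_le_iff
  proof
    fix q assume q: "q \<in> X"
    show "\<phi> ?e q \<le> \<phi> (exp (- t * x) *\<^sub>R Exp (t *\<^sub>R S)) q"
    proof (cases "\<phi> S q < x")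
      case True
      then show ?thesis using q spectral_component_neg[OF q, of "S - x *\<^sub>R u"] by simp
    next
      case False
      then have "0 \<le> t * (\<phi> S q - x)" using assms(1) by simp
      then have "1 \<le> exp (- t * x) * exp (t * \<phi> S q)"
        by (simp add: exp_add[symmetric] algebra_simps)
      then show ?thesis
        using q spectral_component_bounds(2)[OF q, of "S - x *\<^sub>R u"] by simp
    qed
  qed
  then have "T ?e \<le> exp (- t * x) *\<^sub>R T (Exp (t *\<^sub>R S))"
    using T_mono T_simps(3) by metis
  then show ?thesis using assms(2) by (fastforce simp: phi_le_iff)
qed

lemma phi_invertible_nonzero:
  assumes "yosida_invertible K \<phi> u x" "p \<in> X"
  shows "\<phi> x p \<noteq> 0"
proof -
  obtain y where "x \<star> y = u" using assms(1) by (auto simp: yosida_invertible_def)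
  then have "\<phi> x p * \<phi> y p = 1" using assms(2) by (metis phi_mult phi_simps(5))
  then show ?thesis by auto
qed

end

theorem theorem6p5:
  fixes u S v :: "'a::dedekind_complete_riesz_space"
    and K :: "'k topology" and \<phi> :: "'a \<Rightarrow> 'k \<Rightarrow> real"
    and T :: "'a \<Rightarrow> 'a" and f :: "nat \<Rightarrow> 'a" and n :: nat
  assumes "strong_order_unit u"
    and "yosida_representation K \<phi> u"
    and "conditional_expectation T"
    and "strictly_positive T"
    and "T u = u"
    and "indep_elements K \<phi> u T {1..n} f"
    and "\<And>i. i \<in> {1..n} \<Longrightarrow> f i \<le> u"
    and S: "S = (\<Sum>i=1..n. f i - T (f i))"
    and v: "v = (\<Sum>i=1..n. T (yosida_mult K \<phi> (f i) (f i)))"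
  shows "(\<forall>t::real. t > 0 \<longrightarrow>
            yosida_log K \<phi> (T (yosida_exp K \<phi> (t *\<^sub>R S))) \<le> (exp t - t - 1) *\<^sub>R v) \<and>
         (yosida_invertible K \<phi> u v \<longrightarrow>
            (\<forall>x::real. x > 0 \<longrightarrow>
               T (band_proj (band hull {pprt (S - x *\<^sub>R u)}) u) \<le>
               exp (- gauge_norm u v *
                      ((1 + x / gauge_norm u v) * ln (1 + x / gauge_norm u v)
                        - x / gauge_norm u v)) *\<^sub>R u))"
proof -
  interpret yosida_expectation u K \<phi> T
    using assms(1,2,3,5) by unfold_locales
  note mgf = ln_T_Exp_sum_le[OF assms(6,7), folded S v]
  have "yosida_log K \<phi> (T (Exp (t *\<^sub>R S))) \<le> (exp t - t - 1) *\<^sub>R v" if "t > 0" for t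
    using mgf[OF _ that] by (simp add: phi_le_iff phi_log phi_T_Exp_pos)
  moreover have "T (band_proj (band hull {pprt (S - x *\<^sub>R u)}) u) \<le>
      exp (- gauge_norm u v * ((1 + x / gauge_norm u v) * ln (1 + x / gauge_norm u v)
        - x / gauge_norm u v)) *\<^sub>R u"
    if inv: "yosida_invertible K \<phi> u v" and x: "x > 0" for x
    unfolding band_proj_principal_unit phi_le_iff
  proof
    fix p assume p: "p \<in> X"
    define V where "V = gauge_norm u v"
    define t where "t = ln (1 + x / V)"
    have "0 \<le> T (f i \<star> f i)" for i
      using T_mono[of 0 "f i \<star> f i"] by (simp add: T_simps phi_le_iff)
    then have "0 \<le> \<phi> v p"
      using p by (auto simp: v phi_le_iff intro!: sum_nonneg)
    then have V: "0 < V"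
      using phi_invertible_nonzero[OF inv p] phi_le_gauge_norm[OF p, of v] by (simp add: V_def)
    then have t: "t > 0" and exp_t: "exp t = 1 + x / V"
      using x by (simp_all add: t_def add_pos_pos)
    have "ln (\<phi> (T (Exp (t *\<^sub>R S))) p) \<le> (exp t - t - 1) * \<phi> v p"
      by (rule mgf[OF _ t p])
    also have "\<dots> \<le> (exp t - t - 1) * V"
      using phi_le_gauge_norm[OF p, of v] exp_ge_add_one_self[of t]
      unfolding V_def by (intro mult_left_mono) linarith+
    finally have "\<phi> (T (Exp (t *\<^sub>R S))) p \<le> exp ((exp t - t - 1) * V)"
      using phi_T_Exp_pos[OF p] by (metis exp_le_cancel_iff exp_ln)
    then have "exp (- t * x) * \<phi> (T (Exp (t *\<^sub>R S))) p \<le> exp (- t * x) * exp ((exp t - t - 1) * V)"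
      by simp
    also have "\<dots> = exp (- V * ((1 + x / V) * t - x / V))"
      using V by (simp add: exp_add[symmetric] exp_t field_simps)
    finally show "\<phi> (T (spectral_component (S - x *\<^sub>R u))) p \<le>
        \<phi> (exp (- gauge_norm u v * ((1 + x / gauge_norm u v) * ln (1 + x / gauge_norm u v)
          - x / gauge_norm u v)) *\<^sub>R u) p"
      using T_spectral_component_le[of t p S x] t p by (simp add: V_def t_def)
  qed
  ultimately show ?thesis by blast
qed

end
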